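(* Let $n,k>1$ be integers. Set $X=[0,n]$, $m=(2k+3)n$, $Y=m-X=\{m-x : x\in X\}$, $Z=\bigsqcup_{j=1}^{k}[2jn+1,(2j+1)n-1]$, $B=X\sqcup Y\sqcup Z$, $a=2n$, and $A=B\sqcup\{a\}$. Then $|A+A|-|A-A|=1$. Furthermore, set $W=[(2k+4)n,(2k+5)n)$ and $\mathcal{A}=A\sqcup W$. Then $|\mathcal{A}+\mathcal{A}|-|\mathcal{A}-\mathcal{A}|=2$.
   Context: All intervals denote sets of integers, e.g. $[x,y]=\{z\in\mathbb{Z}: x\le z\le y\}$ and $[x,y)=\{z\in\mathbb{Z} : x\le z<y\}$. For $A\subseteq\mathbb{Z}$, $A+A=\{a_1+a_2 : a_1,a_2\in A\}$ and $A-A=\{a_1-a_2 : a_1,a_2\in A\}$. *)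

theory Defs
  imports "HOL-Library.Set_Algebras" "HOL-Library.Disjoint_Sets"
begin

text \<open>
  The sumset is \<open>A + B\<close> from \<open>HOL-Library.Set_Algebras\<close>. On sets, \<open>A - B\<close> is the set-theoretic
  difference, so the set of pairwise differences needs its own constant.
\<close>

definition diffset :: "'a::minus set \<Rightarrow> 'a set \<Rightarrow> 'a set" where
  "diffset A B = {c. \<exists>a\<in>A. \<exists>b\<in>B. c = a - b}"

text \<open>
  The sets of the construction are combined by ordinary unions. The following facts show that these
  unions are automatically disjoint, so that no disjointness hypothesis is needed.
\<close>

context
  fixes n k :: int
  assumes n: "n > 1" and k: "k > 1"
begin

lemma reflected_interval: "(\<lambda>x. (2*k+3)*n - x) ` {0..n} = {(2*k+2)*n..(2*k+3)*n}"
  by (simp add: algebra_simps)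

lemma disjoint_blocks:
  "disjoint_family_on (\<lambda>j. {2*j*n+1..(2*j+1)*n-1}) {1..k}"
proof -
  have *: "{2*i*n+1..(2*i+1)*n-1} \<inter> {2*j*n+1..(2*j+1)*n-1} = {}" if "i < j" for i j
  proof -
    have "(2*i+1)*n \<le> 2*j*n" using that n by (intro mult_right_mono) auto
    then show ?thesis by auto
  qed
  then show ?thesis
    unfolding disjoint_family_on_def by (metis Int_commute linorder_neqE)
qed

lemma blocks_bounds:
  "(\<Union>j\<in>{1..k}. {2*j*n+1..(2*j+1)*n-1}) \<subseteq> {2*n<..<(2*k+1)*n}"
proof -
  have "{2*j*n+1..(2*j+1)*n-1} \<subseteq> {2*n<..<(2*k+1)*n}" if "1 \<le> j" "j \<le> k" for j
  proof -
    have "2*n \<le> 2*j*n" using that n by simp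
    moreover have "(2*j+1)*n \<le> (2*k+1)*n" using that n by (intro mult_right_mono) auto
    ultimately show ?thesis by auto
  qed
  then show ?thesis by (intro UN_least) auto
qed

lemma disjoint_parts:
  defines "X \<equiv> {0..n}"
    and "Y \<equiv> (\<lambda>x. (2*k+3)*n - x) ` {0..n}"
    and "Z \<equiv> (\<Union>j\<in>{1..k}. {2*j*n+1..(2*j+1)*n-1})"
    and "W \<equiv> {(2*k+4)*n..<(2*k+5)*n}"
  shows "X \<inter> Y = {}" "(X \<union> Y) \<inter> Z = {}" "2*n \<notin> X \<union> Y \<union> Z" "(X \<union> Y \<union> Z \<union> {2*n}) \<inter> W = {}"
proof -
  have kn: "k*n > n" using n k by simp
  have Y: "Y \<subseteq> {2*k*n+2*n..2*k*n+3*n}"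
    unfolding Y_def reflected_interval by (simp add: algebra_simps)
  have Z: "Z \<subseteq> {2*n<..<2*k*n+n}"
    using blocks_bounds unfolding Z_def by (simp add: algebra_simps)
  have W: "W \<subseteq> {2*k*n+4*n..}"
    unfolding W_def by (auto simp: algebra_simps)
  have bounds_X: "0 \<le> x \<and> x \<le> n" if "x \<in> X" for x
    using that by (simp add: X_def)
  have bounds_Y: "2*(k*n) + 2*n \<le> x \<and> x \<le> 2*(k*n) + 3*n" if "x \<in> Y" for x
    using that Y by (force simp: mult.assoc)
  have bounds_Z: "2*n < x \<and> x < 2*(k*n) + n" if "x \<in> Z" for x
    using that Z by (force simp: mult.assoc)
  have bounds_W: "2*(k*n) + 4*n \<le> x" if "x \<in> W" for x
    using that W by (force simp: mult.assoc)
  show "X \<inter> Y = {}"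
    using bounds_X bounds_Y n kn by (smt (verit) disjoint_iff)
  show "(X \<union> Y) \<inter> Z = {}"
    using bounds_X bounds_Y bounds_Z n kn by (smt (verit) disjoint_iff Un_iff)
  show "2*n \<notin> X \<union> Y \<union> Z"
    using bounds_X bounds_Y bounds_Z n kn by (smt (verit) Un_iff)
  show "(X \<union> Y \<union> Z \<union> {2*n}) \<inter> W = {}"
    using bounds_X bounds_Y bounds_Z bounds_W n kn by (smt (verit) disjoint_iff Un_iff singletonD)
qed

end

end

theory Submission
  imports Defs
begin

text \<open>
  Write integers as \<open>q * n + r\<close> with \<open>0 \<le> r < n\<close>. Whether such a number belongs to \<open>A\<close> depends only
  on \<open>q\<close> and on whether \<open>r = 0\<close>: the multiples of \<open>n\<close> in \<open>A\<close> have \<open>q \<in> {0, 1, 2, 2k+2, 2k+3}\<close>, and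
  the other elements are those with \<open>q\<close> even, \<open>0 \<le> q \<le> 2k+2\<close>. Adjoining \<open>W\<close> just adds \<open>q = 2k+4\<close> to
  both lists. Computing with quotients shows that the sumset and the difference set are full
  intervals except for some multiples of \<open>n\<close>: \<open>A + A\<close> misses \<open>2in\<close> for \<open>3 \<le> i \<le> k\<close> and
  \<open>k+3 \<le> i \<le> 2k+1\<close> (the second range starts at \<open>k+4\<close> for \<open>A'\<close>), while both difference sets miss
  the multiples \<open>\<plusminus>3n, \<plusminus>5n, \<dots>, \<plusminus>(2k-1)n\<close>. Hence the two pairs of cardinalities differ
  by \<open>(2k-2) - (2k-3) = 1\<close> and \<open>(2k-2) - (2k-4) = 2\<close>.
\<close>

section \<open>Sets described by quotients modulo \<open>n\<close>\<close>

text \<open>Multiples of \<open>n\<close> and the open blocks between them get separate index sets,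
  because \<open>X\<close> and \<open>Y\<close> contain their endpoints while the blocks of
  \<open>Z\<close> omit both.\<close>

definition residue_blocks :: "int \<Rightarrow> int set \<Rightarrow> int set \<Rightarrow> int set" where
  "residue_blocks n Q E = {x. if n dvd x then x div n \<in> Q else x div n \<in> E}"

lemma euclid_unique:
  fixes n q r q' r' :: int
  assumes "q * n + r = q' * n + r'" "0 \<le> r" "r < n" "0 \<le> r'" "r' < n"
  shows "q = q'" "r = r'"
proof -
  have "(q * n + r) div n = q" "(q' * n + r') div n = q'"
    using assms(2-5) by auto
  then show "q = q'" using assms(1) by simp
  then show "r = r'" using assms(1) by simp
qed

lemma euclid_exists:
  fixes n x :: int
  assumes "n > 0"
  obtains q r where "x = q * n + r" "0 \<le> r" "r < n"
  using assms by (metis div_mult_mod_eq pos_mod_bound pos_mod_sign)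

lemma mem_residue_blocks:
  assumes "0 \<le> r" "r < n"
  shows "q * n + r \<in> residue_blocks n Q E \<longleftrightarrow> (if r = 0 then q \<in> Q else q \<in> E)"
proof -
  have "(q * n + r) div n = q" using assms by auto
  moreover have "n dvd q * n + r \<longleftrightarrow> r = 0"
    using assms by (metis dvd_add_right_iff dvd_triv_right dvd_0_right order_le_less zdvd_not_zless)
  ultimately show ?thesis using assms by (auto simp: residue_blocks_def)
qed

lemma set_eq_euclid:
  fixes n :: int
  assumes "n > 0"
    and "\<And>q r. 0 \<le> r \<Longrightarrow> r < n \<Longrightarrow> q * n + r \<in> S \<longleftrightarrow> q * n + r \<in> T"
  shows "S = T"
  using assms by (metis euclid_exists subsetI subset_antisym)

section \<open>Sums and differences by carries and borrows\<close>

text \<open>Two nonzero residues add up to one of 2, ..., n-1 without a carry and to one of 0, ...,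
  n-2 after a carry, which raises the quotient by one. A nonzero and a zero residue give every
  nonzero residue and never carry. So \<open>r = 1\<close> and \<open>r = n - 1\<close> are the
  restrictive cases for \<open>E + E\<close>.\<close>

lemma residue_blocks_plus:
  assumes n: "n > 1" and r: "0 \<le> r" "r < n"
  shows "q * n + r \<in> residue_blocks n Q E + residue_blocks n Q E \<longleftrightarrow>
    (if r = 0 then q \<in> Q + Q \<or> q - 1 \<in> E + E
     else q \<in> E + Q \<or> 2 \<le> r \<and> q \<in> E + E \<or> r \<le> n - 2 \<and> q - 1 \<in> E + E)"
    (is "?l \<longleftrightarrow> ?r")
proof
  assume ?l
  then obtain u v where uv: "u \<in> residue_blocks n Q E" "v \<in> residue_blocks n Q E" "q * n + r = u + v"
    by (auto elim: set_plus_elim)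
  obtain q1 r1 where 1: "u = q1 * n + r1" "0 \<le> r1" "r1 < n" by (rule euclid_exists[of n u]) (use n in auto)
  obtain q2 r2 where 2: "v = q2 * n + r2" "0 \<le> r2" "r2 < n" by (rule euclid_exists[of n v]) (use n in auto)
  have m1: "if r1 = 0 then q1 \<in> Q else q1 \<in> E" and m2: "if r2 = 0 then q2 \<in> Q else q2 \<in> E"
    using uv 1 2 by (simp_all add: mem_residue_blocks)
  have sw: "q2 + q1 \<in> E + Q" if "q1 \<in> Q" "q2 \<in> E" using that by auto
  show ?r
  proof (cases "r1 + r2 < n")
    case True
    have "q * n + r = (q1 + q2) * n + (r1 + r2)" using uv 1 2 by (simp add: algebra_simps)
    then have "q = q1 + q2" "r = r1 + r2" using euclid_unique r True 1 2 by (smt (verit))+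
    then show ?thesis using m1 m2 1 2 sw by (auto split: if_splits simp: add.commute)
  next
    case False
    have "q * n + r = (q1 + q2 + 1) * n + (r1 + r2 - n)" using uv 1 2 by (simp add: algebra_simps)
    then have "q = q1 + q2 + 1" "r = r1 + r2 - n" using euclid_unique r False 1 2 by (smt (verit))+
    then show ?thesis using m1 m2 1 2 False by (auto split: if_splits)
  qed
next
  have I: "q * n + r \<in> residue_blocks n Q E + residue_blocks n Q E"
    if "0 \<le> r1" "r1 < n" "0 \<le> r2" "r2 < n" "if r1 = 0 then q1 \<in> Q else q1 \<in> E"
      "if r2 = 0 then q2 \<in> Q else q2 \<in> E" "q * n + r = (q1 * n + r1) + (q2 * n + r2)" for q1 r1 q2 r2
    using that mem_residue_blocks by (metis set_plus_intro)
  assume ?r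
  then consider (QQ) "r = 0" "q \<in> Q + Q" | (EE0) "r \<le> n - 2" "q - 1 \<in> E + E"
    | (EQ) "r \<noteq> 0" "q \<in> E + Q" | (EE) "2 \<le> r" "q \<in> E + E"
    using n by (auto split: if_splits)
  then show ?l
  proof cases
    case QQ
    then obtain q1 q2 where "q1 \<in> Q" "q2 \<in> Q" "q = q1 + q2" by (auto elim: set_plus_elim)
    then show ?thesis using QQ n by (intro I[of 0 0 q1 q2]) (auto simp: algebra_simps)
  next
    case EE0
    then obtain q1 q2 where "q1 \<in> E" "q2 \<in> E" "q - 1 = q1 + q2" by (auto elim: set_plus_elim)
    moreover from this have "q = q1 + q2 + 1" by simp
    \<comment> \<open>The residues \<open>r + 1\<close> and \<open>n - 1\<close> sum to
      \<open>r + n\<close>, forcing the carry; \<open>r <= n - 2\<close> keeps \<open>r + 1\<close>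
      below \<open>n\<close>.\<close>
    ultimately show ?thesis using EE0 r n by (intro I[of "r + 1" "n - 1" q1 q2]) (auto simp: algebra_simps)
  next
    case EQ
    then obtain q1 q2 where "q1 \<in> E" "q2 \<in> Q" "q = q1 + q2" by (auto elim: set_plus_elim)
    then show ?thesis using EQ r n by (intro I[of r 0 q1 q2]) (auto simp: algebra_simps)
  next
    case EE
    then obtain q1 q2 where "q1 \<in> E" "q2 \<in> E" "q = q1 + q2" by (auto elim: set_plus_elim)
    then show ?thesis using EE r n by (intro I[of "r - 1" 1 q1 q2]) (auto simp: algebra_simps)
  qed
qed

text \<open>A borrow plays the part of the carry. Two nonzero residues differ by 0, ..., n-2 without
  a borrow and give 2, ..., n-1 with one. Nonzero minus zero never borrows and zero minus nonzero
  always does, whence \<open>q + 1\<close> for \<open>Q\<close> minus \<open>E\<close>.\<close>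

lemma residue_blocks_diffset:
  assumes n: "n > 1" and r: "0 \<le> r" "r < n"
  shows "q * n + r \<in> diffset (residue_blocks n Q E) (residue_blocks n Q E) \<longleftrightarrow>
    (if r = 0 then q \<in> diffset Q Q \<or> q \<in> diffset E E
     else q \<in> diffset E Q \<or> q + 1 \<in> diffset Q E
       \<or> r \<le> n - 2 \<and> q \<in> diffset E E \<or> 2 \<le> r \<and> q + 1 \<in> diffset E E)"
    (is "?l \<longleftrightarrow> ?r")
proof
  assume ?l
  then obtain u v where uv: "u \<in> residue_blocks n Q E" "v \<in> residue_blocks n Q E" "q * n + r = u - v"
    by (auto simp: diffset_def)
  obtain q1 r1 where 1: "u = q1 * n + r1" "0 \<le> r1" "r1 < n" by (rule euclid_exists[of n u]) (use n in auto)
  obtain q2 r2 where 2: "v = q2 * n + r2" "0 \<le> r2" "r2 < n" by (rule euclid_exists[of n v]) (use n in auto)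
  have m1: "if r1 = 0 then q1 \<in> Q else q1 \<in> E" and m2: "if r2 = 0 then q2 \<in> Q else q2 \<in> E"
    using uv 1 2 by (simp_all add: mem_residue_blocks)
  show ?r
  proof (cases "r1 \<ge> r2")
    case True
    have "q * n + r = (q1 - q2) * n + (r1 - r2)" using uv 1 2 by (simp add: algebra_simps)
    then have "q = q1 - q2" "r = r1 - r2" using euclid_unique r True 1 2 by (smt (verit))+
    then show ?thesis using m1 m2 1 2 True by (auto split: if_splits simp: diffset_def)
  next
    case False
    have "q * n + r = (q1 - q2 - 1) * n + (r1 - r2 + n)" using uv 1 2 by (simp add: algebra_simps)
    then have "q = q1 - q2 - 1" "r = r1 - r2 + n" using euclid_unique r False 1 2 by (smt (verit))+
    then have "q + 1 = q1 - q2" "r = r1 - r2 + n" by auto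
    then show ?thesis using m1 m2 1 2 False by (auto split: if_splits simp: diffset_def)
  qed
next
  have I: "q * n + r \<in> diffset (residue_blocks n Q E) (residue_blocks n Q E)"
    if "0 \<le> r1" "r1 < n" "0 \<le> r2" "r2 < n" "if r1 = 0 then q1 \<in> Q else q1 \<in> E"
      "if r2 = 0 then q2 \<in> Q else q2 \<in> E" "q * n + r = (q1 * n + r1) - (q2 * n + r2)" for q1 r1 q2 r2
    using that mem_residue_blocks unfolding diffset_def by blast
  assume ?r
  then consider (QQ) "r = 0" "q \<in> diffset Q Q" | (EE) "r \<le> n - 2" "q \<in> diffset E E"
    | (EQ) "r \<noteq> 0" "q \<in> diffset E Q" | (QE) "r \<noteq> 0" "q + 1 \<in> diffset Q E"
    | (EE1) "2 \<le> r" "q + 1 \<in> diffset E E"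
    using n by (auto split: if_splits)
  then show ?l
  proof cases
    case QQ
    then obtain q1 q2 where "q1 \<in> Q" "q2 \<in> Q" "q = q1 - q2" by (auto simp: diffset_def)
    then show ?thesis using QQ n by (intro I[of 0 0 q1 q2]) (auto simp: algebra_simps)
  next
    case EE
    then obtain q1 q2 where "q1 \<in> E" "q2 \<in> E" "q = q1 - q2" by (auto simp: diffset_def)
    then show ?thesis using EE r n by (intro I[of "r + 1" 1 q1 q2]) (auto simp: algebra_simps)
  next
    case EQ
    then obtain q1 q2 where "q1 \<in> E" "q2 \<in> Q" "q = q1 - q2" by (auto simp: diffset_def)
    then show ?thesis using EQ r n by (intro I[of r 0 q1 q2]) (auto simp: algebra_simps)
  next
    case QE
    then obtain q1 q2 where "q1 \<in> Q" "q2 \<in> E" "q + 1 = q1 - q2" by (auto simp: diffset_def)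
    moreover from this have "q = q1 - q2 - 1" by simp
    \<comment> \<open>Subtracting the residue \<open>n - r\<close> from 0 gives
      \<open>r - n\<close>, that is, residue \<open>r\<close> with one borrow.\<close>
    ultimately show ?thesis using QE r n by (intro I[of 0 "n - r" q1 q2]) (auto simp: algebra_simps)
  next
    case EE1
    then obtain q1 q2 where "q1 \<in> E" "q2 \<in> E" "q + 1 = q1 - q2" by (auto simp: diffset_def)
    moreover from this have "q = q1 - q2 - 1" by simp
    ultimately show ?thesis using EE1 r n by (intro I[of "r - 1" "n - 1" q1 q2]) (auto simp: algebra_simps)
  qed
qed

section \<open>Even block indices\<close>

definition doubles_upto :: "int \<Rightarrow> int set" where
  "doubles_upto l = {q. even q \<and> 0 \<le> q \<and> q \<le> 2 * l}"

lemma doubles_upto_plus: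
  assumes "0 \<le> l"
  shows "doubles_upto l + doubles_upto l = {q. even q \<and> 0 \<le> q \<and> q \<le> 4 * l}"
proof -
  have "q \<in> doubles_upto l + doubles_upto l" if q: "even q" "0 \<le> q" "q \<le> 4 * l" for q
  proof (cases "q \<le> 2 * l")
    case True
    then have "q + 0 \<in> doubles_upto l + doubles_upto l"
      using q assms by (intro set_plus_intro) (auto simp: doubles_upto_def)
    then show ?thesis by simp
  next
    case False
    then have "(q - 2 * l) + 2 * l \<in> doubles_upto l + doubles_upto l"
      using q assms by (intro set_plus_intro) (auto simp: doubles_upto_def)
    then show ?thesis by simp
  qed
  moreover have "even q \<and> 0 \<le> q \<and> q \<le> 4 * l" if "q \<in> doubles_upto l + doubles_upto l" for q
    using that by (elim set_plus_elim) (auto simp: doubles_upto_def)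
  ultimately show ?thesis by blast
qed

lemma doubles_upto_diffset:
  assumes "0 \<le> l"
  shows "diffset (doubles_upto l) (doubles_upto l) = {q. even q \<and> - 2 * l \<le> q \<and> q \<le> 2 * l}"
proof -
  have "q \<in> diffset (doubles_upto l) (doubles_upto l)" if q: "even q" "- 2 * l \<le> q" "q \<le> 2 * l" for q
  proof (cases "0 \<le> q")
    case True
    then have "q = q - 0" "q \<in> doubles_upto l" "0 \<in> doubles_upto l" using q assms by (auto simp: doubles_upto_def)
    then show ?thesis unfolding diffset_def by blast
  next
    case False
    then have "q = 0 - (- q)" "- q \<in> doubles_upto l" "0 \<in> doubles_upto l" using q assms by (auto simp: doubles_upto_def)
    then show ?thesis unfolding diffset_def by blast
  qed
  moreover have "even q \<and> - 2 * l \<le> q \<and> q \<le> 2 * l"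
    if "q \<in> diffset (doubles_upto l) (doubles_upto l)" for q
    using that by (auto simp: doubles_upto_def diffset_def)
  ultimately show ?thesis by blast
qed

section \<open>Comparing q n + r with multiples of n\<close>

text \<open>Since \<open>q * n + r\<close> lies in [qn, (q+1)n), weak lower and strict upper bounds
  by multiples of \<open>n\<close> see only the quotient. For the other two kinds of bound, treated
  next, the residue decides the case \<open>q = a\<close>.\<close>

lemma le_mult_euclid:
  fixes n :: int
  assumes "0 \<le> r" "r < n"
  shows "a * n \<le> q * n + r \<longleftrightarrow> a \<le> q" "q * n + r < a * n \<longleftrightarrow> q < a"
proof -
  have "a * n \<le> q * n + r" if "a \<le> q"
    using mult_right_mono[OF that, of n] assms by linarith
  moreover have "q * n + r < a * n" if "q < a"
    using mult_right_mono[of "q + 1" a n] that assms by (simp add: algebra_simps)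
  ultimately show "a * n \<le> q * n + r \<longleftrightarrow> a \<le> q" "q * n + r < a * n \<longleftrightarrow> q < a"
    by (meson linorder_not_less)+
qed

lemma mult_le_euclid:
  fixes n :: int
  assumes "0 \<le> r" "r < n"
  shows "q * n + r \<le> a * n \<longleftrightarrow> q < a \<or> q = a \<and> r = 0" "a * n < q * n + r \<longleftrightarrow> a \<le> q \<and> (q = a \<longrightarrow> r > 0)"
  using le_mult_euclid[OF assms, of a q] assms euclid_unique[of q n r a 0] by auto

text \<open>Serves the upper end of \<open>A' + A'\<close>, which lies \<open>d = 2\<close> below a
  multiple of \<open>n\<close>.\<close>

lemma mult_le_euclid_diff:
  fixes n :: int
  assumes "0 \<le> r" "r < n" "0 < d" "d \<le> n"
  shows "q * n + r \<le> (a + 1) * n - d \<longleftrightarrow> q < a \<or> q = a \<and> r \<le> n - d"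
proof -
  have eq: "(a + 1) * n = a * n + n" by (simp add: algebra_simps)
  consider "q < a" | "q = a" | "a + 1 \<le> q" by linarith
  then show ?thesis
  proof cases
    case 1
    then have "q * n + r < a * n" using le_mult_euclid(2)[OF assms(1,2)] by simp
    then have "q * n + r \<le> (a + 1) * n - d" using eq assms(4) by linarith
    then show ?thesis using 1 by simp
  next
    case 2
    then show ?thesis using eq by auto
  next
    case 3
    then have "(a + 1) * n \<le> q * n + r" using le_mult_euclid(1)[OF assms(1,2)] by simp
    then have "\<not> q * n + r \<le> (a + 1) * n - d" using assms(3) by linarith
    then show ?thesis using 3 by simp
  qed
qed

section \<open>The two given sets in quotient form\<close>

text \<open>\<open>X\<close> supplies the multiples 0, 1 and block 0; its reflection supplies the
  multiples 2k+2, 2k+3 and block 2k+2; \<open>Z\<close> supplies the blocks 2, 4, ..., 2k; the extra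
  point supplies the multiple 2.\<close>

lemma base_set_eq:
  fixes n k :: int
  assumes n: "n > 1" and k: "k > 1"
  shows "{0..n} \<union> (\<lambda>x. (2*k+3)*n - x) ` {0..n} \<union> (\<Union>j\<in>{1..k}. {2*j*n+1..(2*j+1)*n-1}) \<union> {2*n}
    = residue_blocks n {0, 1, 2, 2*k+2, 2*k+3} (doubles_upto (k+1))" (is "?L = _")
proof (rule set_eq_euclid[of n])
  fix q r :: int assume r: "0 \<le> r" "r < n"
  note le = le_mult_euclid[OF r] mult_le_euclid[OF r]
  have X: "q * n + r \<in> {0..n} \<longleftrightarrow> q = 0 \<or> q = 1 \<and> r = 0"
    using le(1)[of 0 q] le(3)[of q 1] by auto
  have Y: "q * n + r \<in> {(2*k+2)*n..(2*k+3)*n} \<longleftrightarrow> q = 2*k+2 \<or> q = 2*k+3 \<and> r = 0"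
    unfolding atLeastAtMost_iff le by auto
  have "q * n + r \<in> {2*j*n+1..(2*j+1)*n-1} \<longleftrightarrow> q = 2 * j \<and> r > 0" for j
    using le(4)[of "2*j" q] le(2)[of q "2*j+1"] by auto
  then have Z: "q * n + r \<in> (\<Union>j\<in>{1..k}. {2*j*n+1..(2*j+1)*n-1}) \<longleftrightarrow> even q \<and> 2 \<le> q \<and> q \<le> 2*k \<and> r > 0"
    by (auto elim!: evenE)
  have W: "q * n + r = 2 * n \<longleftrightarrow> q = 2 \<and> r = 0"
    using euclid_unique[of q n r 2 0] r by auto
  show "q * n + r \<in> ?L \<longleftrightarrow> q * n + r \<in> residue_blocks n {0, 1, 2, 2*k+2, 2*k+3} (doubles_upto (k+1))"
    unfolding reflected_interval[OF n k] Un_iff X Y Z singleton_iff W mem_residue_blocks[OF r] doubles_upto_def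
    using r k by (auto elim!: evenE)
qed (use n in simp)

lemma extended_set_eq:
  fixes n k :: int
  assumes n: "n > 1" and k: "k > 1"
  shows "residue_blocks n {0, 1, 2, 2*k+2, 2*k+3} (doubles_upto (k+1)) \<union> {(2*k+4)*n..<(2*k+5)*n}
    = residue_blocks n {0, 1, 2, 2*k+2, 2*k+3, 2*k+4} (doubles_upto (k+2))"
proof (rule set_eq_euclid[of n])
  fix q r :: int assume r: "0 \<le> r" "r < n"
  have W: "q * n + r \<in> {(2*k+4)*n..<(2*k+5)*n} \<longleftrightarrow> q = 2*k+4"
    unfolding atLeastLessThan_iff le_mult_euclid[OF r] by auto
  show "q * n + r \<in> residue_blocks n {0, 1, 2, 2*k+2, 2*k+3} (doubles_upto (k+1)) \<union> {(2*k+4)*n..<(2*k+5)*n}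
    \<longleftrightarrow> q * n + r \<in> residue_blocks n {0, 1, 2, 2*k+2, 2*k+3, 2*k+4} (doubles_upto (k+2))"
    unfolding Un_iff W mem_residue_blocks[OF r] doubles_upto_def
    using r k by auto presburger
qed (use n in simp)

section \<open>Membership as linear arithmetic with parity\<close>

text \<open>For an explicit finite \<open>Q\<close> this and the next lemmas unfold every membership
  into finitely many inequalities and parity conditions on quotients.\<close>

lemma mem_doubles_plus:
  "q \<in> doubles_upto l + Q \<longleftrightarrow> (\<exists>p\<in>Q. even (q - p) \<and> 0 \<le> q - p \<and> q - p \<le> 2 * l)"
proof -
  have "q \<in> doubles_upto l + Q \<longleftrightarrow> (\<exists>p\<in>Q. q - p \<in> doubles_upto l)"
    by (metis add.commute add_diff_cancel_right' diff_add_cancel set_plus_elim set_plus_intro)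
  then show ?thesis by (simp add: doubles_upto_def)
qed

lemma mem_diffset_doubles:
  "q \<in> diffset (doubles_upto l) Q \<longleftrightarrow> (\<exists>p\<in>Q. even (q + p) \<and> 0 \<le> q + p \<and> q + p \<le> 2 * l)"
  "q \<in> diffset Q (doubles_upto l) \<longleftrightarrow> (\<exists>p\<in>Q. even (p - q) \<and> 0 \<le> p - q \<and> p - q \<le> 2 * l)"
proof -
  have "q \<in> diffset (doubles_upto l) Q \<longleftrightarrow> (\<exists>p\<in>Q. q + p \<in> doubles_upto l)"
    unfolding diffset_def by (auto simp: eq_diff_eq)
  moreover have "q \<in> diffset Q (doubles_upto l) \<longleftrightarrow> (\<exists>p\<in>Q. p - q \<in> doubles_upto l)"
    unfolding diffset_def by (auto simp: algebra_simps) (metis add_diff_cancel_left' add_diff_cancel_right')+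
  ultimately show
    "q \<in> diffset (doubles_upto l) Q \<longleftrightarrow> (\<exists>p\<in>Q. even (q + p) \<and> 0 \<le> q + p \<and> q + p \<le> 2 * l)"
    "q \<in> diffset Q (doubles_upto l) \<longleftrightarrow> (\<exists>p\<in>Q. even (p - q) \<and> 0 \<le> p - q \<and> p - q \<le> 2 * l)"
    by (auto simp: doubles_upto_def)
qed

lemma mem_insert_plus:
  fixes q :: int
  shows "q \<in> insert a P + Q \<longleftrightarrow> q - a \<in> Q \<or> q \<in> P + Q"
proof -
  have "q = a + y \<longleftrightarrow> q - a = y" for y by auto
  then show ?thesis by (auto simp: set_plus_def)
qed

lemma mem_insert_diffset:
  fixes q :: int
  shows "q \<in> diffset (insert a P) Q \<longleftrightarrow> a - q \<in> Q \<or> q \<in> diffset P Q"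
proof -
  have "q = a - y \<longleftrightarrow> a - q = y" for y by auto
  then show ?thesis by (auto simp: diffset_def)
qed

lemma empty_plus_diffset:
  "{} + Q = {}" "diffset {} Q = {}"
  by (auto simp: set_plus_def diffset_def)

lemma mem_even_multiples:
  assumes "0 \<le> r" "r < n"
  shows "(q::int) * n + r \<in> (\<lambda>i. 2 * i * n) ` I \<longleftrightarrow> r = 0 \<and> even q \<and> q div 2 \<in> I"
proof -
  have "q * n + r = 2 * i * n \<longleftrightarrow> q = 2 * i \<and> r = 0" for i
    using euclid_unique[of q n r "2 * i" 0] assms by auto
  then show ?thesis unfolding image_iff by (auto elim!: evenE)
qed

lemma mem_odd_multiples:
  assumes "0 \<le> r" "r < n"
  shows "(q::int) * n + r \<in> (\<lambda>i. (2 * i + 1) * n) ` I \<longleftrightarrow> r = 0 \<and> odd q \<and> q div 2 \<in> I"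
proof -
  have "q * n + r = (2 * i + 1) * n \<longleftrightarrow> q = 2 * i + 1 \<and> r = 0" for i
    using euclid_unique[of q n r "2 * i + 1" 0] assms by auto
  then show ?thesis unfolding image_iff by (auto elim!: oddE)
qed

section \<open>The sumsets and difference sets explicitly\<close>

text \<open>\<open>E + Q\<close> contains all quotients 0, ..., 4k+5, so only multiples of
  \<open>n\<close> can be missing. Odd quotients come from \<open>E + E\<close> with a carry. Even
  ones come from \<open>Q + Q\<close>, which has just 0, 2, 4, 2k+2, 2k+4, 4k+4, 4k+6.\<close>

lemma base_plus:
  fixes n k :: int
  defines "S \<equiv> residue_blocks n {0, 1, 2, 2*k+2, 2*k+3} (doubles_upto (k+1))"
  assumes n: "n > 1" and k: "k > 1"
  shows "S + S = {0..(4*k+6)*n} - (\<lambda>i. 2 * i * n) ` ({3..k} \<union> {k+3..2*k+1})"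
proof (rule set_eq_euclid[of n])
  fix q r :: int assume r: "0 \<le> r" "r < n"
  have I: "q * n + r \<in> {0..(4*k+6)*n} \<longleftrightarrow> 0 \<le> q \<and> (q < 4*k+6 \<or> q = 4*k+6 \<and> r = 0)"
    using le_mult_euclid(1)[OF r, of 0 q] mult_le_euclid(1)[OF r] by auto
  have l: "0 \<le> k + 1" using k by simp
  show "q * n + r \<in> S + S \<longleftrightarrow>
    q * n + r \<in> {0..(4*k+6)*n} - (\<lambda>i. 2 * i * n) ` ({3..k} \<union> {k+3..2*k+1})"
    unfolding S_def residue_blocks_plus[OF n r] Diff_iff I mem_even_multiples[OF r] mem_doubles_plus
      doubles_upto_plus[OF l] mem_insert_plus empty_plus_diffset
    using r k n
    \<comment> \<open>With the parity of \<open>q\<close> and the vanishing of \<open>r\<close>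
      fixed, what remains is linear in half the quotient, \<open>k\<close>, \<open>r\<close> and
      \<open>n\<close>.\<close>
    by (cases "even q"; cases "r = 0"; elim evenE oddE; simp; presburger)
qed (use n in simp)

text \<open>The new index fills one gap, 2k+6 = 2 + (2k+4), using the extra point \<open>2n\<close>.
  At the top quotient 4k+9 only \<open>E + E\<close> with a carry contributes, hence the end
  \<open>(4*k+10)*n-2\<close>.\<close>

lemma extended_plus:
  fixes n k :: int
  defines "S \<equiv> residue_blocks n {0, 1, 2, 2*k+2, 2*k+3, 2*k+4} (doubles_upto (k+2))"
  assumes n: "n > 1" and k: "k > 1"
  shows "S + S = {0..(4*k+10)*n-2} - (\<lambda>i. 2 * i * n) ` ({3..k} \<union> {k+4..2*k+1})"
proof (rule set_eq_euclid[of n])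
  fix q r :: int assume r: "0 \<le> r" "r < n"
  have "q * n + r \<le> (4*k+10)*n-2 \<longleftrightarrow> q < 4*k+9 \<or> q = 4*k+9 \<and> r \<le> n - 2"
    using mult_le_euclid_diff[OF r, of 2 q "4*k+9"] n by (simp add: add.commute)
  then have I: "q * n + r \<in> {0..(4*k+10)*n-2} \<longleftrightarrow> 0 \<le> q \<and> (q < 4*k+9 \<or> q = 4*k+9 \<and> r \<le> n - 2)"
    using le_mult_euclid(1)[OF r, of 0 q] by auto
  have l: "0 \<le> k + 2" using k by simp
  show "q * n + r \<in> S + S \<longleftrightarrow>
    q * n + r \<in> {0..(4*k+10)*n-2} - (\<lambda>i. 2 * i * n) ` ({3..k} \<union> {k+4..2*k+1})"
    unfolding S_def residue_blocks_plus[OF n r] Diff_iff I mem_even_multiples[OF r] mem_doubles_plus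
      doubles_upto_plus[OF l] mem_insert_plus empty_plus_diffset
    using r k n
    by (cases "even q"; cases "r = 0"; elim evenE oddE; simp; presburger)
qed (use n in simp)

text \<open>\<open>E\<close> minus \<open>Q\<close> covers every nonzero residue in range, and
  \<open>E\<close> minus \<open>E\<close> covers the even multiples. Odd multiples need
  \<open>Q\<close> minus \<open>Q\<close>, whose odd members are only 1, 2k+1, 2k+3 up to
  sign.\<close>

lemma base_diffset:
  fixes n k :: int
  defines "S \<equiv> residue_blocks n {0, 1, 2, 2*k+2, 2*k+3} (doubles_upto (k+1))"
  assumes n: "n > 1" and k: "k > 1"
  shows "diffset S S = {-((2*k+3)*n)..(2*k+3)*n} - (\<lambda>i. (2 * i + 1) * n) ` ({-k..-2} \<union> {1..k-1})"
proof (rule set_eq_euclid[of n])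
  fix q r :: int assume r: "0 \<le> r" "r < n"
  have I: "q * n + r \<in> {-((2*k+3)*n)..(2*k+3)*n} \<longleftrightarrow> -(2*k+3) \<le> q \<and> (q < 2*k+3 \<or> q = 2*k+3 \<and> r = 0)"
    unfolding atLeastAtMost_iff mult_minus_left[symmetric] le_mult_euclid[OF r] mult_le_euclid[OF r] by (rule refl)
  have l: "0 \<le> k + 1" using k by simp
  show "q * n + r \<in> diffset S S \<longleftrightarrow>
    q * n + r \<in> {-((2*k+3)*n)..(2*k+3)*n} - (\<lambda>i. (2 * i + 1) * n) ` ({-k..-2} \<union> {1..k-1})"
    unfolding S_def residue_blocks_diffset[OF n r] Diff_iff I mem_odd_multiples[OF r] mem_diffset_doubles
      doubles_upto_diffset[OF l] mem_insert_diffset empty_plus_diffset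
    using r k n
    by (cases "even q"; cases "r = 0"; elim evenE oddE; simp; presburger)
qed (use n in simp)

text \<open>The index 2k+4 yields the odd differences 1 and 2k+3 up to sign, both present before, so
  the gaps stay the same while the interval grows.\<close>

lemma extended_diffset:
  fixes n k :: int
  defines "S \<equiv> residue_blocks n {0, 1, 2, 2*k+2, 2*k+3, 2*k+4} (doubles_upto (k+2))"
  assumes n: "n > 1" and k: "k > 1"
  shows "diffset S S = {-((2*k+5)*n-1)..(2*k+5)*n-1} - (\<lambda>i. (2 * i + 1) * n) ` ({-k..-2} \<union> {1..k-1})"
proof (rule set_eq_euclid[of n])
  fix q r :: int assume r: "0 \<le> r" "r < n"
  \<comment> \<open>Integer endpoints one away from a multiple of \<open>n\<close> become strict
    bounds, to which the quotient comparisons apply.\<close>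
  have "q * n + r \<in> {-((2*k+5)*n-1)..(2*k+5)*n-1} \<longleftrightarrow> q * n + r < (2*k+5)*n \<and> -(2*k+5)*n < q * n + r"
    unfolding mult_minus_left by auto
  then have I: "q * n + r \<in> {-((2*k+5)*n-1)..(2*k+5)*n-1} \<longleftrightarrow>
    q < 2*k+5 \<and> -(2*k+5) \<le> q \<and> (q = -(2*k+5) \<longrightarrow> r > 0)"
    unfolding le_mult_euclid[OF r] mult_le_euclid[OF r] .
  have l: "0 \<le> k + 2" using k by simp
  show "q * n + r \<in> diffset S S \<longleftrightarrow>
    q * n + r \<in> {-((2*k+5)*n-1)..(2*k+5)*n-1} - (\<lambda>i. (2 * i + 1) * n) ` ({-k..-2} \<union> {1..k-1})"
    unfolding S_def residue_blocks_diffset[OF n r] Diff_iff I mem_odd_multiples[OF r] mem_diffset_doubles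
      doubles_upto_diffset[OF l] mem_insert_diffset empty_plus_diffset
    using r k n
    by (cases "even q"; cases "r = 0"; elim evenE oddE; simp; presburger)
qed (use n in simp)

section \<open>Counting\<close>

lemma card_Icc_Diff_image:
  fixes a b :: int
  assumes "finite I" "inj_on f I" "f ` I \<subseteq> {a..b}" "a \<le> b"
  shows "int (card ({a..b} - f ` I)) = b - a + 1 - int (card I)"
proof -
  have "card (f ` I) \<le> card {a..b}" using assms by (intro card_mono) auto
  then show ?thesis using assms by (simp add: card_Diff_subset card_image of_nat_diff)
qed

text \<open>The weak bounds admit empty intervals: for \<open>k = 2\<close> both
  \<open>{3..k}\<close> and \<open>{k+4..2*k+1}\<close> are empty.\<close>

lemma card_two_Icc:
  fixes a b c d :: int
  assumes "a \<le> b + 1" "b < c" "c \<le> d + 1"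
  shows "int (card ({a..b} \<union> {c..d})) = (b - a + 1) + (d - c + 1)"
  using assms by (subst card_Un_disjoint) auto

theorem theorem6:
  fixes n k m a :: int and X Y Z B A W A' :: "int set"
  assumes "n > 1" and "k > 1"
    and "X = {0..n}"
    and "m = (2*k+3)*n"
    and "Y = (\<lambda>x. m - x) ` X"
    and "Z = (\<Union>j\<in>{1..k}. {2*j*n+1..(2*j+1)*n-1})"
    and "B = X \<union> Y \<union> Z"
    and "a = 2*n"
    and "A = B \<union> {a}"
    and "W = {(2*k+4)*n..<(2*k+5)*n}"
    and "A' = A \<union> W"
  shows "int (card (A + A)) - int (card (diffset A A)) = 1
    \<and> int (card (A' + A')) - int (card (diffset A' A')) = 2"
proof -
  have n: "n > 1" and k: "k > 1" using assms(1,2) by auto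
  have A: "A = residue_blocks n {0, 1, 2, 2*k+2, 2*k+3} (doubles_upto (k+1))"
    using base_set_eq[OF n k] assms(3-9) by simp
  have A': "A' = residue_blocks n {0, 1, 2, 2*k+2, 2*k+3, 2*k+4} (doubles_upto (k+2))"
    using extended_set_eq[OF n k] A assms(10,11) by simp
  have mono: "p * n \<le> q * n" if "p \<le> q" for p q :: int using that n by (intro mult_right_mono) auto
  have inj_even: "inj_on (\<lambda>i. 2 * i * n) I" and inj_odd: "inj_on (\<lambda>i. (2 * i + 1) * n) I" for I
    using n by (auto intro!: inj_onI)
  have "int (card (A + A)) = (4*k+6)*n + 1 - (2*k-3)"
  proof -
    have "(\<lambda>i. 2 * i * n) ` ({3..k} \<union> {k+3..2*k+1}) \<subseteq> {0..(4*k+6)*n}"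
      using mono[of 0] mono[of _ "4*k+6"] k by auto
    then show ?thesis
      unfolding A base_plus[OF n k]
      using k n by (subst card_Icc_Diff_image) (auto simp: card_two_Icc inj_even)
  qed
  moreover have "int (card (diffset A A)) = 2*((2*k+3)*n) + 1 - (2*k-2)"
  proof -
    have "(\<lambda>i. (2 * i + 1) * n) ` ({-k..-2} \<union> {1..k-1}) \<subseteq> {-((2*k+3)*n)..(2*k+3)*n}"
      using mono[of "-(2*k+3)"] mono[of _ "2*k+3"] k unfolding mult_minus_left by auto
    then show ?thesis
      unfolding A base_diffset[OF n k]
      using k n by (subst card_Icc_Diff_image) (auto simp: card_two_Icc inj_odd)
  qed
  moreover have "int (card (A' + A')) = (4*k+10)*n - 1 - (2*k-4)"
  proof -
    have "(\<lambda>i. 2 * i * n) ` ({3..k} \<union> {k+4..2*k+1}) \<subseteq> {0..(4*k+10)*n-2}"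
    proof -
      \<comment> \<open>Stepping down a whole multiple of \<open>n\<close> absorbs the 2, because
        \<open>n >= 2\<close>; the gaps can then be bounded by comparing coefficients.\<close>
      have "(4*k+9)*n \<le> (4*k+10)*n-2" using n by (simp add: algebra_simps)
      moreover have "0 \<le> 2 * i * n \<and> 2 * i * n \<le> (4*k+9)*n" if "i \<in> {3..k} \<union> {k+4..2*k+1}" for i
        using mono[of 0 "2 * i"] mono[of "2 * i" "4*k+9"] that k by auto
      ultimately show ?thesis by force
    qed
    moreover have "0 \<le> (4*k+10)*n-2" using mono[of 1 "4*k+10"] n k by linarith
    ultimately show ?thesis
      unfolding A' extended_plus[OF n k]
      using k n by (subst card_Icc_Diff_image) (auto simp: card_two_Icc inj_even)
  qed
  moreover have "int (card (diffset A' A')) = 2*((2*k+5)*n-1) + 1 - (2*k-2)"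
  proof -
    have "(\<lambda>i. (2 * i + 1) * n) ` ({-k..-2} \<union> {1..k-1}) \<subseteq> {-((2*k+5)*n-1)..(2*k+5)*n-1}"
    proof -
      have "(2*k+4)*n \<le> (2*k+5)*n-1" using n by (simp add: algebra_simps)
      moreover have "-((2*k+4)*n) \<le> (2 * i + 1) * n \<and> (2 * i + 1) * n \<le> (2*k+4)*n"
        if "i \<in> {-k..-2} \<union> {1..k-1}" for i
        using mono[of "-(2*k+4)" "2 * i + 1"] mono[of "2 * i + 1" "2*k+4"] that k
        unfolding mult_minus_left by auto
      ultimately show ?thesis by force
    qed
    moreover have "-((2*k+5)*n-1) \<le> (2*k+5)*n-1" using mono[of 1 "2*k+5"] n k by linarith
    ultimately show ?thesis
      unfolding A' extended_diffset[OF n k]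
      using k n by (subst card_Icc_Diff_image) (auto simp: card_two_Icc inj_odd)
  qed
  \<comment> \<open>In each pair the sumset and the difference set span intervals of equal length,
    so only the numbers of gaps are compared.\<close>
  ultimately show ?thesis by (simp add: algebra_simps)
qed

end
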